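(* Let $n\ge 1$ be an integer, let $p\in[0,1]$, and set $q=1-p$. Let $X_1,\ldots,X_n$ be independent and identically distributed Bernoulli random variables with $P(X_1=1)=p$ and $P(X_1=0)=q$. Let $L_n$ be the length of the longest run of consecutive successes (ones) among $X_1,\ldots,X_n$, and for an integer $r$ put $y_{n,r}=P(L_n\ge r)$. If $r$ is an integer with $n/2\le r\le n$, then $$y_{n,r}=p^{r}+(n-r)\,p^{r}q.$$
   Context: The longest success run is defined by $L_n=\max\{k : X_{i+1}=\cdots=X_{i+k}=1 \text{ for some } i\in\{0,1,\ldots,n-k\}\}$, where $k$ ranges over $\{0,1,\ldots,n\}$ (the condition is vacuous for $k=0$, so $L_n=0$ if all $X_j=0$). Thus $y_{n,r}$ is the probability that at least $r$ consecutive successes occur somewhere in the $n$ trials. *)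

theory Defs
  imports "HOL-Probability.Probability"
begin

(* Trials are indexed by 1..n.  The set contains k = 0 vacuously, so the Max is over a
   finite nonempty set and the value is 0 when no trial is a success. *)
definition longest_success_run :: "nat \<Rightarrow> (nat \<Rightarrow> real) \<Rightarrow> nat" where
  "longest_success_run n x =
     Max {k \<in> {0..n}. \<exists>i\<in>{0..n - k}. \<forall>j\<in>{1..k}. x (i + j) = 1}"

definition run_prob :: "'a measure \<Rightarrow> (nat \<Rightarrow> 'a \<Rightarrow> real) \<Rightarrow> nat \<Rightarrow> nat \<Rightarrow> real" where
  "run_prob M X n r = \<P>(\<omega> in M. longest_success_run n (\<lambda>i. X i \<omega>) \<ge> r)"

end

theory Submission
  imports Defs
begin

text \<open>Split the event that some run of length at least \<open>r\<close> occurs according to the start of the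
  first window of \<open>r\<close> successes: either it is \<open>1, \<dots>, r\<close>, or it is \<open>i + 1, \<dots>, i + r\<close> with
  \<open>1 \<le> i \<le> n - r\<close>, preceded by a failure at \<open>i\<close>. Since \<open>n \<le> 2 r\<close>, that is \<open>i \<le> r\<close>, the
  failure preceding the later of two such windows lies inside the earlier one, so the cases are
  mutually exclusive; their probabilities are \<open>p ^ r\<close> and \<open>q * p ^ r\<close>.\<close>

text \<open>Only the left end is pinned: successes may continue past \<open>i + r\<close>. The
  disjunct \<open>i = 0\<close> covers the initial window, which no trial precedes.\<close>

definition first_run_at :: "nat \<Rightarrow> nat \<Rightarrow> (nat \<Rightarrow> real) \<Rightarrow> bool" where
  "first_run_at r i x \<longleftrightarrow> (i = 0 \<or> x i \<noteq> 1) \<and> (\<forall>j\<in>{i+1..i+r}. x j = 1)"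

text \<open>Cutting a run of length \<open>k \<ge> r\<close> on the right leaves a run of length
  \<open>r\<close> with the same start, so the set under \<open>Max\<close> is downward
  closed.\<close>

lemma longest_success_run_ge_iff:
  assumes "r \<le> n"
  shows "r \<le> longest_success_run n x \<longleftrightarrow> (\<exists>i\<le>n - r. \<forall>j\<in>{i+1..i+r}. x j = 1)"
proof -
  let ?S = "{k \<in> {0..n}. \<exists>i\<in>{0..n - k}. \<forall>j\<in>{1..k}. x (i + j) = 1}"
  have fin: "finite ?S" and "0 \<in> ?S" by auto
  then have ne: "?S \<noteq> {}" by blast
  have "r \<le> longest_success_run n x \<longleftrightarrow> (\<exists>k\<in>?S. r \<le> k)"
    unfolding longest_success_run_def by (rule Max_ge_iff[OF fin ne])
  also have "\<dots> \<longleftrightarrow> r \<in> ?S"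
  proof
    assume "\<exists>k\<in>?S. r \<le> k"
    then obtain k i where "r \<le> k" "k \<le> n" "i \<le> n - k" "\<forall>j\<in>{1..k}. x (i + j) = 1"
      by auto
    then show "r \<in> ?S"
      using assms by (auto intro!: bexI[of _ i])
  qed auto
  also have "\<dots> \<longleftrightarrow> (\<exists>i\<le>n - r. \<forall>j\<in>{i+1..i+r}. x j = 1)"
  proof -
    have "(\<forall>j\<in>{1..r}. x (i + j) = 1) \<longleftrightarrow> (\<forall>j\<in>{i+1..i+r}. x j = 1)" for i
    proof -
      have "{i+1..i+r} = (+) i ` {1..r}" by simp
      then show ?thesis by (simp only: Set.ball_simps(9))
    qed
    then show ?thesis using assms by auto
  qed
  finally show ?thesis .
qed

text \<open>The leftmost window of successes is the witness: a success just before it would allow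
  shifting it left by one.\<close>

lemma longest_success_run_ge_iff_first_run:
  assumes "r \<le> n"
  shows "r \<le> longest_success_run n x \<longleftrightarrow> (\<exists>i\<le>n - r. first_run_at r i x)"
proof -
  have "\<exists>i\<le>n - r. first_run_at r i x"
    if ex: "\<exists>i\<le>n - r. \<forall>j\<in>{i+1..i+r}. x j = 1"
  proof -
    let ?P = "\<lambda>i. \<forall>j\<in>{i+1..i+r}. x j = 1"
    define i where "i = (LEAST i. ?P i)"
    obtain k where k: "k \<le> n - r" "?P k" using ex by auto
    have i: "?P i" "i \<le> k" unfolding i_def using k(2) by (rule LeastI, rule Least_le)
    have "x i \<noteq> 1" if "i \<noteq> 0"
    proof
      assume "x i = 1"
      have "?P (i - 1)"
      proof
        fix j assume "j \<in> {i - 1 + 1..i - 1 + r}"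
        then have "j = i \<or> j \<in> {i+1..i+r}" using that by auto
        then show "x j = 1" using i(1) \<open>x i = 1\<close> by auto
      qed
      then have "i \<le> i - 1" unfolding i_def by (rule Least_le)
      then show False using that by simp
    qed
    then show ?thesis
      using i k(1) unfolding first_run_at_def by (intro exI[of _ i]) auto
  qed
  then show ?thesis
    unfolding longest_success_run_ge_iff[OF assms] by (auto simp: first_run_at_def)
qed

lemma first_run_at_unique:
  assumes "first_run_at r i x" "first_run_at r k x" "i \<le> r" "k \<le> r"
  shows "i = k"
proof (rule ccontr)
  assume "i \<noteq> k"
  then consider "i < k" | "k < i" by linarith
  then show False
    \<comment> \<open>If \<open>i < k\<close>, then \<open>k \<le> r \<le> i + r\<close> puts
      \<open>k\<close>, where \<open>x k \<noteq> 1\<close>, inside the window after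
      \<open>i\<close>; the other case is symmetric.\<close>
    using assms by cases (auto simp: first_run_at_def)
qed

context prob_space
begin

text \<open>The event constrains distinct trials separately, so independence turns its probability
  into a product with one factor per trial.\<close>

lemma prob_first_run_at:
  fixes X :: "nat \<Rightarrow> 'a \<Rightarrow> real"
  assumes indep: "indep_vars (\<lambda>_. borel) X {1..n}"
    and p: "\<And>i. i \<in> {1..n} \<Longrightarrow> \<P>(\<omega> in M. X i \<omega> = 1) = p"
    and "i + r \<le> n" "r \<ge> 1"
  shows "\<P>(\<omega> in M. first_run_at r i (\<lambda>j. X j \<omega>)) = (if i = 0 then p ^ r else (1 - p) * p ^ r)"
proof -
  \<comment> \<open>Index 0 is left out: it is no trial, and independence covers only
    \<open>{1..n}\<close>.\<close>
  define J where "J = (if i = 0 then {} else {i}) \<union> {i+1..i+r}"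
  \<comment> \<open>Failure is encoded as the complement of \<open>{1}\<close>, so its probability
    follows from that of success.\<close>
  define A where "A = (\<lambda>j. if j = i then - {1} else {1::real})"
  \<comment> \<open>Nonemptiness comes from \<open>r \<ge> 1\<close>; \<open>indep_varsD\<close>
    requires it, and it keeps the intersection over \<open>J\<close> inside
    \<open>space M\<close>.\<close>
  have J: "J \<noteq> {}" "finite J" "J \<subseteq> {1..n}"
    using assms(3,4) by (auto simp: J_def)
  have rv: "X j \<in> borel_measurable M" if "j \<in> {1..n}" for j
    using indep that by (auto simp: indep_vars_def)
  have prob_A: "prob (X j -` A j \<inter> space M) = (if j = i then 1 - p else p)" if "j \<in> J" for j
  proof -
    have j: "j \<in> {1..n}" using that J by auto
    have 1: "X j -` {1} \<inter> space M = {\<omega> \<in> space M. X j \<omega> = 1}" by auto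
    have "X j -` (- {1}) \<inter> space M = space M - {\<omega> \<in> space M. X j \<omega> = 1}" by auto
    moreover have "{\<omega> \<in> space M. X j \<omega> = 1} \<in> events" using rv[OF j] by measurable
    ultimately show ?thesis using p[OF j] 1 unfolding A_def
      by (cases "j = i") (simp_all only: prob_compl if_True if_False refl)
  qed
  have "{\<omega> \<in> space M. first_run_at r i (\<lambda>j. X j \<omega>)} = (\<Inter>j\<in>J. X j -` A j \<inter> space M)"
  proof (intro set_eqI)
    fix \<omega>
    have "first_run_at r i (\<lambda>j. X j \<omega>) \<longleftrightarrow> (\<forall>j\<in>J. X j \<omega> \<in> A j)"
    proof -
      have "(\<forall>j\<in>{i+1..i+r}. X j \<omega> \<in> A j) \<longleftrightarrow> (\<forall>j\<in>{i+1..i+r}. X j \<omega> = 1)"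
        by (intro ball_cong refl) (auto simp: A_def)
      then show ?thesis
        unfolding first_run_at_def J_def ball_Un by (simp add: A_def)
    qed
    then show "\<omega> \<in> {\<omega> \<in> space M. first_run_at r i (\<lambda>j. X j \<omega>)} \<longleftrightarrow>
        \<omega> \<in> (\<Inter>j\<in>J. X j -` A j \<inter> space M)"
      using J(1) by blast
  qed
  then have "\<P>(\<omega> in M. first_run_at r i (\<lambda>j. X j \<omega>)) = (\<Prod>j\<in>J. prob (X j -` A j \<inter> space M))"
    using indep_varsD[OF indep J, of A] by (auto simp: A_def)
  also have "\<dots> = (\<Prod>j\<in>J. if j = i then 1 - p else p)"
    by (intro prod.cong refl prob_A)
  also have "\<dots> = (if i = 0 then p ^ r else (1 - p) * p ^ r)"
  proof (cases "i = 0")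
    case True
    then have "(\<Prod>j\<in>J. if j = i then 1 - p else p) = (\<Prod>j\<in>{1..r}. p)"
      by (intro prod.cong) (auto simp: J_def)
    then show ?thesis using True by simp
  next
    case False
    then have "(\<Prod>j\<in>J. if j = i then 1 - p else p)
        = (1 - p) * (\<Prod>j\<in>{i+1..i+r}. if j = i then 1 - p else p)"
      by (simp add: J_def)
    also have "(\<Prod>j\<in>{i+1..i+r}. if j = i then 1 - p else p) = (\<Prod>j\<in>{i+1..i+r}. p)"
      by (intro prod.cong) auto
    finally show ?thesis using False by simp
  qed
  finally show ?thesis .
qed

end

theorem corollary1:
  fixes M :: "'a measure" and X :: "nat \<Rightarrow> 'a \<Rightarrow> real"
    and n r :: nat and p q :: real
  assumes "prob_space M"
    and "n \<ge> 1"
    and "p \<in> {0..1}" and "q = 1 - p"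
    and "prob_space.indep_vars M (\<lambda>_. borel) X {1..n}"
    and "\<And>i. i \<in> {1..n} \<Longrightarrow> \<P>(\<omega> in M. X i \<omega> = 1) = p"
    and "\<And>i. i \<in> {1..n} \<Longrightarrow> \<P>(\<omega> in M. X i \<omega> = 0) = q"
    and "real n / 2 \<le> real r" and "r \<le> n"
  shows "run_prob M X n r = p ^ r + (real n - real r) * p ^ r * q"
proof -
  interpret prob_space M by fact
  have r: "r \<ge> 1" "n \<le> 2 * r" using assms(2,8) by linarith+
  define E where "E i = {\<omega> \<in> space M. first_run_at r i (\<lambda>j. X j \<omega>)}" for i
  have [measurable]: "X j \<in> borel_measurable M" if "j \<in> {1..n}" for j
    using assms(5) that by (auto simp: indep_vars_def)
  have E_events: "E i \<in> events" if "i \<le> n - r" for i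
  proof -
    have "E i = {\<omega> \<in> space M. (i = 0 \<or> X i \<omega> \<noteq> 1)} \<inter>
        {\<omega> \<in> space M. \<forall>j\<in>{i+1..i+r}. X j \<omega> = 1}"
      by (auto simp: E_def first_run_at_def)
    \<comment> \<open>Measurability is known only for \<open>X 1\<close> to \<open>X n\<close>, so
      \<open>i = 0\<close>, where the condition is trivially true, is treated apart.\<close>
    moreover have "{\<omega> \<in> space M. (i = 0 \<or> X i \<omega> \<noteq> 1)} \<in> events"
      using that by (cases "i = 0") auto
    moreover have "{\<omega> \<in> space M. \<forall>j\<in>{i+1..i+r}. X j \<omega> = 1} \<in> events"
      using that assms(9) by (intro sets.sets_Collect_finite_All) auto
    ultimately show ?thesis by (simp only: sets.Int)
  qed
  have "disjoint_family_on E {..n - r}"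
    unfolding disjoint_family_on_def
  proof (intro ballI impI)
    fix i k assume "i \<in> {..n - r}" "k \<in> {..n - r}" "i \<noteq> k"
    \<comment> \<open>Here \<open>n \<le> 2 * r\<close> enters: \<open>i \<le> n - r \<le> r\<close>
      is the bound that uniqueness requires.\<close>
    moreover have "i \<le> r" "k \<le> r" using calculation(1,2) r(2) by auto
    ultimately show "E i \<inter> E k = {}"
      unfolding E_def using first_run_at_unique by blast
  qed
  moreover have "{\<omega> \<in> space M. r \<le> longest_success_run n (\<lambda>i. X i \<omega>)} = (\<Union>i\<le>n - r. E i)"
    using longest_success_run_ge_iff_first_run[OF assms(9)] by (auto simp: E_def)
  ultimately have "run_prob M X n r = (\<Sum>i\<le>n - r. prob (E i))"
    unfolding run_prob_def using E_events by (subst finite_measure_finite_Union[symmetric]) auto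
  also have "\<dots> = (\<Sum>i\<le>n - r. if i = 0 then p ^ r else (1 - p) * p ^ r)"
    unfolding E_def using assms(9) r(1)
    by (intro sum.cong refl prob_first_run_at[OF assms(5,6)]) auto
  \<comment> \<open>The initial window is split off; each of the other \<open>n - r\<close> starts
    carries the extra factor of a preceding failure.\<close>
  also have "\<dots> = p ^ r + (\<Sum>i\<in>{1..n - r}. (1 - p) * p ^ r)"
    by (simp add: atMost_atLeast0 sum.atLeast_Suc_atMost)
  also have "\<dots> = p ^ r + (real n - real r) * p ^ r * q"
    using assms(4,9) by (simp add: of_nat_diff)
  finally show ?thesis .
qed

end
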